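(* Let $U:\mathbb{R}^d\to\mathbb{R}$ be twice differentiable with $\mu\mathrm{I}_d\preceq\nabla^2U(z)\preceq L\mathrm{I}_d$ for all $z$, where $\mu\in(0,+\infty)$, $L\in[0,+\infty)$, and let $q_*=\mathrm{Normal}(m_*,\Sigma_* )\in\arg\min_{q\in\mathrm{BW}(\mathbb{R}^d)}\mathcal{F}(q)$. Then for any $q\in\mathrm{BW}(\mathbb{R}^d)$ and any coupling $\psi$ of $q$ and $q_*$, $$\mathbb{E}_{Z\sim q}\big\|\nabla U(Z)-\mathbb{E}_{q_*}\nabla U\big\|_2^2\le 4L\,\mathbb{E}_{(X,X_* )\sim\psi}[\mathrm{D}_U(X,X_* )]+2dL.$$
   Context: $\mathrm{BW}(\mathbb{R}^d)$ is the set of nondegenerate Gaussians on $\mathbb{R}^d$; $\mathcal{F}(q)=\int U\,\mathrm{d}q+\int\log q\,\mathrm{d}q$; $\mathrm{D}_U(x,y)=U(x)-U(y)-\langle\nabla U(y),x-y\rangle$. *)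

theory Defs
  imports "HOL-Probability.Probability"
begin

text \<open>Symmetric positive definite d x d matrices (covariances of nondegenerate Gaussians).\<close>
definition pos_def_mat :: "real^'n^'n \<Rightarrow> bool" where
  "pos_def_mat S \<longleftrightarrow> transpose S = S \<and> (\<forall>x. x \<noteq> 0 \<longrightarrow> x \<bullet> (S *v x) > 0)"

text \<open>Density of Normal(m, S) on R^d with respect to Lebesgue measure.\<close>
definition gauss_pdf :: "real^'n \<Rightarrow> real^'n^'n \<Rightarrow> real^'n \<Rightarrow> real" where
  "gauss_pdf m S x =
     (2 * pi) powr (- real CARD('n) / 2) * (det S) powr (- 1 / 2)
     * exp (- ((x - m) \<bullet> (matrix_inv S *v (x - m))) / 2)"

text \<open>The Gaussian measure Normal(m, S).\<close>
definition gauss :: "real^'n \<Rightarrow> real^'n^'n \<Rightarrow> (real^'n) measure" where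
  "gauss m S = density lborel (\<lambda>x. ennreal (gauss_pdf m S x))"

text \<open>BW(R^d): the set of nondegenerate Gaussians.\<close>
definition BW :: "(real^'n) measure set" where
  "BW = {gauss m S | m S. pos_def_mat S}"

text \<open>Free energy F(q) = int U dq + int log q dq, for q = Normal(m,S) in BW.\<close>
definition free_energy :: "(real^'n \<Rightarrow> real) \<Rightarrow> real^'n \<Rightarrow> real^'n^'n \<Rightarrow> real" where
  "free_energy U m S =
     (\<integral>x. U x \<partial>gauss m S) + (\<integral>x. ln (gauss_pdf m S x) \<partial>gauss m S)"

text \<open>Bregman divergence D_U(x,y) = U x - U y - <grad U y, x - y>.\<close>
definition bregman :: "(real^'n \<Rightarrow> real) \<Rightarrow> (real^'n \<Rightarrow> real^'n) \<Rightarrow> real^'n \<Rightarrow> real^'n \<Rightarrow> real" where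
  "bregman U gradU x y = U x - U y - gradU y \<bullet> (x - y)"

end

theory Submission
  imports Defs
begin

text \<open>The Hessian bounds make \<open>U\<close> convex and \<open>L\<close>-smooth, hence
  \<open>\<parallel>\<nabla>U x - \<nabla>U y\<parallel>\<^sup>2 \<le> 2 L D\<^sub>U(x, y)\<close>.
  Splitting \<open>\<nabla>U x - E\<^sub>q\<^sub>*\<nabla>U\<close> through \<open>\<nabla>U y\<close> and integrating over the coupling
  reduces the claim to the variance bound \<open>E\<^sub>q\<^sub>*\<parallel>\<nabla>U - E\<^sub>q\<^sub>*\<nabla>U\<parallel>\<^sup>2 \<le> d L\<close>.
  For this, compare \<open>q\<^sub>* = Normal(m\<^sub>*, \<Sigma>\<^sub>*)\<close> with its dilations
  \<open>Normal(m\<^sub>*, t\<^sup>2 \<Sigma>\<^sub>*)\<close>: the entropy term of the free energy changes by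
  \<open>-d ln t\<close>, while smoothness bounds the change of the potential term, so minimality
  as \<open>t \<rightarrow> 1\<^sup>-\<close> gives \<open>E\<^sub>q\<^sub>*\<langle>\<nabla>U X, X - m\<^sub>*\<rangle> \<le> d\<close>.
  Cocoercivity of \<open>\<nabla>U\<close> and \<open>E\<^sub>q\<^sub>*(X - m\<^sub>*) = 0\<close> turn this into
  \<open>E\<^sub>q\<^sub>*\<parallel>\<nabla>U X - \<nabla>U m\<^sub>*\<parallel>\<^sup>2 \<le> d L\<close>, which dominates the variance.\<close>

section \<open>Convex functions with Lipschitz gradient\<close>

lemma second_order_mean_value:
  fixes U :: "'a::real_inner \<Rightarrow> real"
  assumes grad: "\<And>z. (U has_derivative (\<lambda>h. gradU z \<bullet> h)) (at z)"
    and hess: "\<And>z. (gradU has_derivative H z) (at z)"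
  obtains t where "0 < t" "t < 1" "U (x + h) = U x + gradU x \<bullet> h + h \<bullet> H (x + t *\<^sub>R h) h / 2"
proof -
  define g0 where "g0 = (\<lambda>s::real. U (x + s *\<^sub>R h))"
  define g1 where "g1 = (\<lambda>s::real. gradU (x + s *\<^sub>R h) \<bullet> h)"
  define g2 where "g2 = (\<lambda>s::real. h \<bullet> H (x + s *\<^sub>R h) h)"
  have line: "((\<lambda>s. x + s *\<^sub>R h) has_derivative (\<lambda>r. r *\<^sub>R h)) (at s)" for s
    by (auto intro!: derivative_eq_intros)
  have "(g0 has_real_derivative g1 s) (at s)" for s
    using has_derivative_compose[OF line grad]
    unfolding g0_def g1_def has_field_derivative_def
    by (rule has_derivative_eq_rhs) (auto simp: fun_eq_iff)
  moreover have "(g1 has_real_derivative g2 s) (at s)" for s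
  proof -
    have "((\<lambda>s. gradU (x + s *\<^sub>R h)) has_derivative (\<lambda>r. H (x + s *\<^sub>R h) (r *\<^sub>R h))) (at s)"
      by (rule has_derivative_compose[OF line hess])
    moreover have "linear (H (x + s *\<^sub>R h))"
      using hess has_derivative_linear by blast
    ultimately show ?thesis
      unfolding g1_def g2_def has_field_derivative_def
      by (elim has_derivative_inner_left[THEN has_derivative_eq_rhs])
        (auto simp: fun_eq_iff linear_scale inner_commute)
  qed
  ultimately have "\<exists>t. 0 < t \<and> t < 1 \<and> g0 1 = g0 0 + g1 0 + g2 t / 2"
    using Taylor[of 2 "\<lambda>k. if k = 0 then g0 else if k = 1 then g1 else g2" g0 0 1 0 1]
    by (auto simp: less_2_cases_iff eval_nat_numeral)
  then show ?thesis
    using that unfolding g0_def g1_def g2_def by auto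
qed

lemma norm_diff_sq_le_triangle:
  fixes a b c :: "'a::real_normed_vector"
  shows "(norm (a - c))\<^sup>2 \<le> 2 * (norm (a - b))\<^sup>2 + 2 * (norm (b - c))\<^sup>2"
proof -
  have "(norm (a - c))\<^sup>2 \<le> (norm (a - b) + norm (b - c))\<^sup>2"
    using norm_triangle_ineq[of "a - b" "b - c"] by (intro power_mono) auto
  also have "\<dots> \<le> 2 * (norm (a - b))\<^sup>2 + 2 * (norm (b - c))\<^sup>2"
    using zero_le_power2[of "norm (a - b) - norm (b - c)"]
    by (simp add: power2_eq_square algebra_simps)
  finally show ?thesis .
qed

locale convex_smooth =
  fixes U :: "'a::real_inner \<Rightarrow> real" and gradU :: "'a \<Rightarrow> 'a" and L :: real
  assumes L_pos: "L > 0"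
    and tangent_le: "U x + gradU x \<bullet> h \<le> U (x + h)"
    and le_tangent_plus_sq: "U (x + h) \<le> U x + gradU x \<bullet> h + L / 2 * (norm h)\<^sup>2"

lemma convex_smoothI_hessian:
  fixes U :: "'a::euclidean_space \<Rightarrow> real"
  assumes grad: "\<And>z. (U has_derivative (\<lambda>h. gradU z \<bullet> h)) (at z)"
    and hess: "\<And>z. (gradU has_derivative H z) (at z)"
    and hess_lower: "\<And>z h. \<mu> * (norm h)\<^sup>2 \<le> h \<bullet> H z h"
    and hess_upper: "\<And>z h. h \<bullet> H z h \<le> L * (norm h)\<^sup>2"
    and mu_pos: "\<mu> > 0"
  shows "convex_smooth U gradU L"
proof
  obtain b :: 'a where "b \<in> Basis"
    using nonempty_Basis by blast
  then show "L > 0"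
    using hess_lower[of b 0] hess_upper[of b 0] mu_pos by (simp add: norm_Basis)
next
  fix x h
  obtain t where "U (x + h) = U x + gradU x \<bullet> h + h \<bullet> H (x + t *\<^sub>R h) h / 2"
    using second_order_mean_value[OF grad hess] .
  moreover have "0 \<le> h \<bullet> H (x + t *\<^sub>R h) h"
    using hess_lower[of h "x + t *\<^sub>R h"] mu_pos
    by (meson order_trans zero_le_mult_iff zero_le_power2 less_imp_le)
  ultimately show "U x + gradU x \<bullet> h \<le> U (x + h)"
    and "U (x + h) \<le> U x + gradU x \<bullet> h + L / 2 * (norm h)\<^sup>2"
    using hess_upper[of h "x + t *\<^sub>R h"] by auto
qed

context convex_smooth
begin

lemma norm_gradU_diff_sq_le:
  "(norm (gradU x - gradU y))\<^sup>2 \<le> 2 * L * (U x - U y - gradU y \<bullet> (x - y))"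
proof -
  define g where "g = gradU x - gradU y"
  \<comment> \<open>Sandwich \<open>U\<close> at the gradient step \<open>x + h\<close> between the smoothness bound at \<open>x\<close>
    and the tangent bound at \<open>y\<close>.\<close>
  define h where "h = - (1 / L) *\<^sub>R g"
  have "norm h = norm g / L"
    using L_pos by (simp add: h_def)
  then have upper: "U (x + h) \<le> U x - (gradU x \<bullet> g) / L + (norm g)\<^sup>2 / (2 * L)"
    using le_tangent_plus_sq[of x h] L_pos by (simp add: h_def power2_eq_square)
  have lower: "U y + gradU y \<bullet> (x - y) - (gradU y \<bullet> g) / L \<le> U (x + h)"
    using tangent_le[of y "x + h - y"] by (simp add: h_def inner_diff_right inner_add_right)
  have "(gradU x - gradU y) \<bullet> g = (norm g)\<^sup>2"
    by (simp add: g_def power2_norm_eq_inner)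
  then have "(gradU x \<bullet> g) / L = (gradU y \<bullet> g) / L + (norm g)\<^sup>2 / L"
    by (simp add: inner_diff_left flip: add_divide_distrib)
  moreover have "(norm g)\<^sup>2 / L = (norm g)\<^sup>2 / (2 * L) + (norm g)\<^sup>2 / (2 * L)"
    by simp
  ultimately have "(norm g)\<^sup>2 / (2 * L) \<le> U x - U y - gradU y \<bullet> (x - y)"
    using upper lower by linarith
  then show ?thesis
    using L_pos unfolding g_def by (simp add: field_simps)
qed

lemma gradU_cocoercive:
  "(norm (gradU x - gradU y))\<^sup>2 \<le> L * ((gradU x - gradU y) \<bullet> (x - y))"
  using norm_gradU_diff_sq_le[of x y] norm_gradU_diff_sq_le[of y x]
  by (simp add: norm_minus_commute algebra_simps inner_diff_right inner_diff_left)

lemma gradU_lipschitz: "norm (gradU x - gradU y) \<le> L * norm (x - y)"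
proof -
  have "(norm (gradU x - gradU y))\<^sup>2 \<le> L * ((gradU x - gradU y) \<bullet> (x - y))"
    by (rule gradU_cocoercive)
  also have "\<dots> \<le> L * (norm (gradU x - gradU y) * norm (x - y))"
    using L_pos by (intro mult_left_mono norm_cauchy_schwarz) auto
  finally show ?thesis
    using L_pos by (cases "gradU x = gradU y") (auto simp: power2_eq_square)
qed

lemma continuous_on_gradU: "continuous_on A gradU"
  using gradU_lipschitz L_pos
  by (intro lipschitz_on_continuous_on[where L = L] lipschitz_onI) (auto simp: dist_norm)

lemma continuous_on_U: "continuous_on A U"
proof -
  have "(\<lambda>h. U (x + h)) \<midarrow>0\<rightarrow> U x" for x
  proof (rule real_tendsto_sandwich)
    show "\<forall>\<^sub>F h in at 0. U x + gradU x \<bullet> h \<le> U (x + h)"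
      "\<forall>\<^sub>F h in at 0. U (x + h) \<le> U x + gradU x \<bullet> h + L / 2 * (norm h)\<^sup>2"
      by (intro always_eventually allI tangent_le le_tangent_plus_sq)+
    show "((\<lambda>h. U x + gradU x \<bullet> h) \<longlongrightarrow> U x) (at 0)"
      "((\<lambda>h. U x + gradU x \<bullet> h + L / 2 * (norm h)\<^sup>2) \<longlongrightarrow> U x) (at 0)"
      by (auto intro!: tendsto_eq_intros)
  qed
  then show ?thesis
    by (intro continuous_at_imp_continuous_on) (simp add: isCont_def LIM_offset_zero_iff)
qed

lemma borel_measurable_U[measurable]: "U \<in> borel_measurable borel"
  by (rule borel_measurable_continuous_onI[OF continuous_on_U])

lemma borel_measurable_gradU[measurable]: "gradU \<in> borel_measurable borel"
  by (rule borel_measurable_continuous_onI[OF continuous_on_gradU])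

lemma abs_U_le_quadratic:
  "\<bar>U y\<bar> \<le> \<bar>U m\<bar> + norm (gradU m) * norm (y - m) + L / 2 * (norm (y - m))\<^sup>2"
  using tangent_le[of m "y - m"] le_tangent_plus_sq[of m "y - m"] L_pos
    Cauchy_Schwarz_ineq2[of "gradU m" "y - m"]
  by (simp add: abs_le_iff) linarith

lemma norm_gradU_sub_sq_le:
  "(norm (gradU x - c))\<^sup>2 \<le> 4 * L * (U x - U y - gradU y \<bullet> (x - y)) + 2 * (norm (gradU y - c))\<^sup>2"
  using norm_diff_sq_le_triangle[of "gradU x" c "gradU y"] norm_gradU_diff_sq_le[of x y] by simp

lemma norm_gradU_le_affine: "norm (gradU y) \<le> norm (gradU m) + L * norm (y - m)"
  using norm_triangle_sub[of "gradU y" "gradU m"] gradU_lipschitz[of y m] by simp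

end

section \<open>Positive definite matrices and Gaussian densities\<close>

lemma quadratic_form_pos_imp_invertible:
  fixes A :: "real^'n^'n"
  assumes pos: "\<And>x. x \<noteq> 0 \<Longrightarrow> x \<bullet> (A *v x) > 0"
  shows "invertible A"
proof -
  have "inj ((*v) A)"
  proof (rule injI)
    fix x y assume "A *v x = A *v y"
    then have "A *v (x - y) = 0" by (simp add: matrix_vector_mult_diff_distrib)
    then show "x = y" using pos[of "x - y"] by (cases "x = y") auto
  qed
  then show ?thesis
    by (simp add: invertible_det_nz det_nz_iff_inj[symmetric])
qed

lemma pos_def_mat_invertible: "pos_def_mat S \<Longrightarrow> invertible S"
  unfolding pos_def_mat_def by (intro quadratic_form_pos_imp_invertible) auto

text \<open>The determinant cannot vanish along the segment of positive definite matrices from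
  \<open>mat 1\<close> to \<open>S\<close>, so by continuity it keeps the sign of \<open>det (mat 1) = 1\<close>.\<close>
lemma pos_def_mat_det_pos:
  fixes S :: "real^'n^'n"
  assumes S: "pos_def_mat S"
  shows "det S > 0"
proof (rule ccontr)
  assume "\<not> det S > 0"
  define f where "f = (\<lambda>s::real. det ((1 - s) *\<^sub>R mat 1 + s *\<^sub>R S))"
  have "continuous_on {0..1} f"
    unfolding f_def det_def by (auto intro!: continuous_intros)
  moreover have "f 1 \<le> 0" "0 \<le> f 0"
    using \<open>\<not> det S > 0\<close> by (auto simp: f_def)
  ultimately obtain s where s: "0 \<le> s" "s \<le> 1" "f s = 0"
    using IVT2'[of f 1 0 0] by auto
  have "invertible ((1 - s) *\<^sub>R mat 1 + s *\<^sub>R S)"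
  proof (rule quadratic_form_pos_imp_invertible)
    fix x :: "real^'n" assume "x \<noteq> 0"
    then have "x \<bullet> x > 0" "x \<bullet> (S *v x) > 0"
      using S unfolding pos_def_mat_def by auto
    then have "(1 - s) * (x \<bullet> x) + s * (x \<bullet> (S *v x)) > 0"
      using s by (cases "s = 0") (auto intro: add_nonneg_pos)
    then show "x \<bullet> (((1 - s) *\<^sub>R mat 1 + s *\<^sub>R S) *v x) > 0"
      by (simp add: matrix_vector_mult_add_rdistrib scaleR_matrix_vector_assoc[symmetric]
          inner_add_right)
  qed
  then show False
    using s by (simp add: invertible_det_nz f_def)
qed

lemma pos_def_mat_scaleR: "pos_def_mat S \<Longrightarrow> k > 0 \<Longrightarrow> pos_def_mat (k *\<^sub>R S)"
  unfolding pos_def_mat_def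
  by (auto simp: transpose_scalar scaleR_matrix_vector_assoc[symmetric])

lemma matrix_inv_cancel:
  fixes S :: "real^'n^'n"
  assumes "invertible S"
  shows "S ** matrix_inv S = mat 1" "matrix_inv S ** S = mat 1"
proof -
  have "\<exists>A'. S ** A' = mat 1 \<and> A' ** S = mat 1"
    using assms unfolding invertible_def by blast
  then have "S ** matrix_inv S = mat 1 \<and> matrix_inv S ** S = mat 1"
    unfolding matrix_inv_def by (rule someI_ex)
  then show "S ** matrix_inv S = mat 1" "matrix_inv S ** S = mat 1"
    by auto
qed

lemma matrix_inv_scaleR:
  fixes S :: "real^'n^'n"
  assumes "invertible S" "k \<noteq> 0"
  shows "matrix_inv (k *\<^sub>R S) = (1 / k) *\<^sub>R matrix_inv S"
proof -
  have kS: "invertible (k *\<^sub>R S)"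
    by (rule scalar_invertible[OF assms(2,1)])
  have "matrix_inv (k *\<^sub>R S) = matrix_inv (k *\<^sub>R S) ** (S ** matrix_inv S)"
    using matrix_inv_cancel(1)[OF assms(1)] by simp
  also have "\<dots> = (matrix_inv (k *\<^sub>R S) ** S) ** matrix_inv S"
    by (simp add: matrix_mul_assoc)
  also have "matrix_inv (k *\<^sub>R S) ** S = (1 / k) *\<^sub>R (matrix_inv (k *\<^sub>R S) ** (k *\<^sub>R S))"
    using assms(2) by (simp add: matrix_scalar_ac scalar_matrix_assoc[symmetric])
  also have "\<dots> = (1 / k) *\<^sub>R mat 1"
    using matrix_inv_cancel(2)[OF kS] by simp
  finally show ?thesis
    by (simp add: scalar_matrix_assoc[symmetric])
qed

lemma det_scaleR: "det (k *\<^sub>R S) = k ^ CARD('n) * det (S :: real^'n^'n)"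
proof -
  have "k *\<^sub>R S = (\<chi> i. k *s (S $ i))"
    by vector
  then show ?thesis
    using det_rows_mul[of "\<lambda>i. k" "\<lambda>i. S $ i"] by simp
qed

lemma pos_def_mat_inverse_quadratic_form_pos:
  assumes S: "pos_def_mat S" and "y \<noteq> 0"
  shows "y \<bullet> (matrix_inv S *v y) > 0"
proof -
  define v where "v = matrix_inv S *v y"
  have Sv: "S *v v = y"
    unfolding v_def using matrix_inv_cancel(1)[OF pos_def_mat_invertible[OF S]]
    by (simp add: matrix_vector_mul_assoc)
  with \<open>y \<noteq> 0\<close> have "v \<noteq> 0"
    by auto
  then have "v \<bullet> (S *v v) > 0"
    using S unfolding pos_def_mat_def by blast
  then show ?thesis
    using Sv by (simp add: v_def inner_commute)
qed

lemma abs_quadratic_form_le_onorm: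
  fixes A :: "real^'n^'n"
  shows "\<bar>y \<bullet> (A *v y)\<bar> \<le> onorm ((*v) A) * (norm y)\<^sup>2"
proof -
  have "\<bar>y \<bullet> (A *v y)\<bar> \<le> norm y * norm (A *v y)"
    by (rule Cauchy_Schwarz_ineq2)
  also have "\<dots> \<le> norm y * (onorm ((*v) A) * norm y)"
    by (intro mult_left_mono onorm) auto
  finally show ?thesis
    by (simp add: power2_eq_square algebra_simps)
qed

text \<open>A positive quadratic form attains a positive minimum on the unit sphere.\<close>
lemma quadratic_form_pos_imp_coercive:
  fixes A :: "real^'n^'n"
  assumes pos: "\<And>x. x \<noteq> 0 \<Longrightarrow> x \<bullet> (A *v x) > 0"
  obtains l where "l > 0" "\<And>y. l * (norm y)\<^sup>2 \<le> y \<bullet> (A *v y)"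
proof -
  obtain b :: "real^'n" where "b \<in> Basis"
    using nonempty_Basis by blast
  then have "sphere (0::real^'n) 1 \<noteq> {}"
    by (auto simp: norm_Basis)
  moreover have "continuous_on (sphere 0 1) (\<lambda>y::real^'n. y \<bullet> (A *v y))"
    by (intro continuous_intros)
  ultimately obtain z where z: "z \<in> sphere 0 1"
    and zmin: "\<And>y. y \<in> sphere 0 1 \<Longrightarrow> z \<bullet> (A *v z) \<le> y \<bullet> (A *v y)"
    using continuous_attains_inf[OF compact_sphere] by blast
  have "z \<bullet> (A *v z) * (norm y)\<^sup>2 \<le> y \<bullet> (A *v y)" for y
  proof (cases "y = 0")
    case False
    define u where "u = (1 / norm y) *\<^sub>R y"
    have "z \<bullet> (A *v z) \<le> u \<bullet> (A *v u)"
      using False by (intro zmin) (simp add: u_def)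
    also have "u \<bullet> (A *v u) = (y \<bullet> (A *v y)) / (norm y)\<^sup>2"
      by (simp add: u_def matrix_vector_mult_scaleR power2_eq_square)
    finally show ?thesis
      using False by (simp add: pos_le_divide_eq)
  qed simp
  moreover have "z \<bullet> (A *v z) > 0"
    using pos z by (metis mem_sphere_0 norm_zero zero_neq_one)
  ultimately show ?thesis
    using that by blast
qed

lemma continuous_on_gauss_pdf: "continuous_on A (gauss_pdf m S)"
proof -
  have "continuous_on A (\<lambda>x. matrix_inv S *v (x - m))"
    by (intro continuous_on_compose2[OF matrix_vector_mult_linear_continuous_on[of UNIV]]
        continuous_intros) auto
  then show ?thesis
    unfolding gauss_pdf_def[abs_def] by (intro continuous_intros) auto
qed

lemma borel_measurable_gauss_pdf[measurable]: "gauss_pdf m S \<in> borel_measurable borel"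
  by (rule borel_measurable_continuous_onI[OF continuous_on_gauss_pdf])

lemma gauss_pdf_pos:
  assumes "pos_def_mat S"
  shows "gauss_pdf m S x > 0"
  using pos_def_mat_det_pos[OF assms] unfolding gauss_pdf_def by simp

lemma gauss_pdf_eq_at_mean:
  "gauss_pdf m S x = gauss_pdf m S m * exp (- ((x - m) \<bullet> (matrix_inv S *v (x - m))) / 2)"
  unfolding gauss_pdf_def by simp

lemma sets_gauss[simp, measurable_cong]: "sets (gauss m S) = sets borel"
  by (simp add: gauss_def)

lemma space_gauss[simp]: "space (gauss m S) = UNIV"
  by (simp add: gauss_def)

lemma gauss_pdf_dilate:
  fixes S :: "real^'n^'n"
  assumes S: "pos_def_mat S" and t: "t \<noteq> 0"
  shows "gauss_pdf m ((t^2) *\<^sub>R S) (m + t *\<^sub>R (x - m)) * \<bar>t\<bar> ^ CARD('n) = gauss_pdf m S x"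
proof -
  have "matrix_inv ((t^2) *\<^sub>R S) = (1 / t^2) *\<^sub>R matrix_inv S"
    using t by (simp add: matrix_inv_scaleR pos_def_mat_invertible[OF S])
  then have exponent: "(t *\<^sub>R (x - m)) \<bullet> (matrix_inv ((t^2) *\<^sub>R S) *v (t *\<^sub>R (x - m)))
      = (x - m) \<bullet> (matrix_inv S *v (x - m))"
    using t by (simp add: scaleR_matrix_vector_assoc[symmetric] matrix_vector_mult_scaleR
        power2_eq_square)
  have "(det ((t^2) *\<^sub>R S)) powr (-1/2) = ((\<bar>t\<bar> ^ CARD('n))^2) powr (-1/2) * det S powr (-1/2)"
    using pos_def_mat_det_pos[OF S]
    by (simp add: det_scaleR powr_mult power_mult[symmetric] power_even_abs mult.commute)
  also have "((\<bar>t\<bar> ^ CARD('n))^2) powr (-1/2) = inverse (\<bar>t\<bar> ^ CARD('n))"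
    using t by (simp add: powr_minus_divide powr_half_sqrt inverse_eq_divide)
  finally show ?thesis
    unfolding gauss_pdf_def using exponent t by simp
qed

lemma distr_gauss_dilate:
  fixes S :: "real^'n^'n"
  assumes S: "pos_def_mat S" and t: "t \<noteq> 0"
  shows "distr (gauss m S) lborel (\<lambda>x. m + t *\<^sub>R (x - m)) = gauss m ((t^2) *\<^sub>R S)"
proof -
  define T where "T = (\<lambda>x::real^'n. (m - t *\<^sub>R m) + t *\<^sub>R x)"
  have T_eq: "T = (\<lambda>x. m + t *\<^sub>R (x - m))"
    by (auto simp: T_def algebra_simps)
  have [measurable]: "T \<in> borel_measurable borel"
    unfolding T_def by measurable
  have pdf: "ennreal (\<bar>t\<bar> ^ CARD('n)) * ennreal (gauss_pdf m ((t^2) *\<^sub>R S) (T x))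
      = ennreal (gauss_pdf m S x)" for x
    using gauss_pdf_dilate[OF S t, of m x] gauss_pdf_pos[OF pos_def_mat_scaleR[OF S], of "t^2" m]
      t unfolding T_eq by (simp add: ennreal_mult'[symmetric] less_imp_le mult.commute)
  have "gauss m ((t^2) *\<^sub>R S)
      = density (density (distr lborel borel T) (\<lambda>_. \<bar>t\<bar> ^ CARD('n)))
          (\<lambda>x. gauss_pdf m ((t^2) *\<^sub>R S) x)"
    unfolding gauss_def T_def using lborel_affine[OF t, of "m - t *\<^sub>R m"] by simp
  also have "\<dots> = density (distr lborel borel T)
      (\<lambda>x. ennreal (\<bar>t\<bar> ^ CARD('n)) * ennreal (gauss_pdf m ((t^2) *\<^sub>R S) x))"
    by (subst density_density_eq) auto
  also have "\<dots> = distr (gauss m S) borel T"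
    unfolding gauss_def pdf[symmetric] by (subst density_distr) auto
  finally show ?thesis
    unfolding T_eq by (auto intro: distr_cong)
qed

lemma prob_space_gauss_dilate:
  fixes S :: "real^'n^'n"
  assumes "prob_space (gauss m S)" and "pos_def_mat S" and "t \<noteq> 0"
  shows "prob_space (gauss m ((t^2) *\<^sub>R S))"
  using prob_space.prob_space_distr[OF assms(1), of "\<lambda>x. m + t *\<^sub>R (x - m)" lborel]
  unfolding distr_gauss_dilate[OF assms(2,3)] by simp

lemma mul_exp_neg_half_le: "(u::real) * exp (- u / 2) \<le> 4 * exp (- u / 4)"
proof -
  have "u / 4 \<le> exp (u / 4)"
    using exp_ge_add_one_self[of "u / 4"] by linarith
  then have "u * exp (- u / 2) \<le> 4 * exp (u / 4) * exp (- u / 2)"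
    by (intro mult_right_mono) auto
  also have "\<dots> = 4 * exp (- u / 4)"
    by (simp add: mult.assoc exp_add[symmetric])
  finally show ?thesis .
qed

lemma gauss_pdf_mul_norm_sq_le:
  fixes S :: "real^'n^'n"
  assumes S: "pos_def_mat S"
  obtains K where "\<And>x. gauss_pdf m S x * (norm (x - m))\<^sup>2 \<le> K * gauss_pdf m (2 *\<^sub>R S) x"
proof -
  define Q where "Q = (\<lambda>y. y \<bullet> (matrix_inv S *v y))"
  obtain l where l: "l > 0" "\<And>y. l * (norm y)\<^sup>2 \<le> Q y"
    using quadratic_form_pos_imp_coercive pos_def_mat_inverse_quadratic_form_pos[OF S]
    unfolding Q_def by metis
  define c1 where "c1 = gauss_pdf m S m"
  define c2 where "c2 = gauss_pdf m (2 *\<^sub>R S) m"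
  have "c1 > 0" "c2 > 0"
    unfolding c1_def c2_def using S by (simp_all add: gauss_pdf_pos pos_def_mat_scaleR)
  have "matrix_inv (2 *\<^sub>R S) = (1/2) *\<^sub>R matrix_inv S"
    by (simp add: matrix_inv_scaleR pos_def_mat_invertible[OF S])
  then have pdf2: "gauss_pdf m (2 *\<^sub>R S) x = c2 * exp (- Q (x - m) / 4)" for x
    unfolding c2_def Q_def
    by (subst gauss_pdf_eq_at_mean) (simp add: scaleR_matrix_vector_assoc[symmetric])
  have "gauss_pdf m S x * (norm (x - m))\<^sup>2 \<le> (4 * c1 / (l * c2)) * gauss_pdf m (2 *\<^sub>R S) x" for x
  proof -
    define u where "u = Q (x - m)"
    have "gauss_pdf m S x * (norm (x - m))\<^sup>2 \<le> c1 * exp (- u / 2) * (u / l)"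
      using l \<open>c1 > 0\<close> unfolding u_def c1_def Q_def
      by (subst gauss_pdf_eq_at_mean) (intro mult_left_mono, auto simp: pos_le_divide_eq mult.commute)
    also have "\<dots> = (c1 / l) * (u * exp (- u / 2))"
      by simp
    also have "\<dots> \<le> (c1 / l) * (4 * exp (- u / 4))"
      using mul_exp_neg_half_le[of u] \<open>c1 > 0\<close> l by (intro mult_left_mono) auto
    also have "\<dots> = (4 * c1 / (l * c2)) * gauss_pdf m (2 *\<^sub>R S) x"
      unfolding pdf2 u_def using \<open>c2 > 0\<close> by simp
    finally show ?thesis .
  qed
  then show ?thesis
    using that by blast
qed

section \<open>Moments of a nondegenerate Gaussian and the optimality of \<open>q\<^sub>*\<close>\<close>

lemma (in prob_space) integral_norm_sq_diff_expectation_le: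
  fixes f :: "'a \<Rightarrow> 'b::euclidean_space"
  assumes f: "integrable M f" and sq: "integrable M (\<lambda>x. (norm (f x - a))\<^sup>2)"
  shows "integrable M (\<lambda>x. (norm (f x - expectation f))\<^sup>2)"
    and "(\<integral>x. (norm (f x - expectation f))\<^sup>2 \<partial>M) \<le> (\<integral>x. (norm (f x - a))\<^sup>2 \<partial>M)"
proof -
  define w where "w = expectation f - a"
  have expand: "(norm (f x - expectation f))\<^sup>2 = (norm (f x - a))\<^sup>2 - 2 * ((f x - a) \<bullet> w) + (norm w)\<^sup>2"
    for x
    unfolding w_def by (simp add: power2_norm_eq_inner inner_diff_left inner_diff_right inner_commute)
  have fa: "integrable M (\<lambda>x. f x - a)"
    using f by simp
  show "integrable M (\<lambda>x. (norm (f x - expectation f))\<^sup>2)"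
    unfolding expand using sq fa by auto
  have "(\<integral>x. (norm (f x - expectation f))\<^sup>2 \<partial>M)
      = (\<integral>x. (norm (f x - a))\<^sup>2 \<partial>M) - 2 * ((\<integral>x. f x - a \<partial>M) \<bullet> w) + (norm w)\<^sup>2"
    unfolding expand using sq fa by (simp add: prob_space)
  also have "(\<integral>x. f x - a \<partial>M) = w"
    unfolding w_def using f by (simp add: prob_space)
  finally show "(\<integral>x. (norm (f x - expectation f))\<^sup>2 \<partial>M) \<le> (\<integral>x. (norm (f x - a))\<^sup>2 \<partial>M)"
    by (simp add: power2_norm_eq_inner)
qed

lemma minus_ln_one_minus_le:
  fixes s :: real
  assumes "0 < s" "s < 1"
  shows "- ln (1 - s) \<le> s / (1 - s)"
proof -
  have "ln (inverse (1 - s)) \<le> inverse (1 - s) - 1"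
    using assms by (intro ln_le_minus_one) auto
  moreover have "ln (inverse (1 - s)) = - ln (1 - s)" "inverse (1 - s) - 1 = s / (1 - s)"
    using assms by (simp_all add: ln_div field_simps)
  ultimately show ?thesis
    by simp
qed

locale nondegenerate_gaussian = prob_space "gauss m S"
  for m :: "real^'n" and S :: "real^'n^'n" +
  assumes pos_def: "pos_def_mat S"
begin

lemma integrable_norm_sq: "integrable (gauss m S) (\<lambda>x. (norm (x - m))\<^sup>2)"
proof (rule integrableI_nonneg)
  obtain K where K: "\<And>x. gauss_pdf m S x * (norm (x - m))\<^sup>2 \<le> K * gauss_pdf m (2 *\<^sub>R S) x"
    using gauss_pdf_mul_norm_sq_le[OF pos_def] by blast
  have "K \<ge> 0"
    using K[of m] gauss_pdf_pos[OF pos_def_mat_scaleR[OF pos_def], of 2 m m]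
    by (simp add: zero_le_mult_iff)
  \<comment> \<open>\<open>Normal(m, 2 S)\<close> is the image of \<open>Normal(m, S)\<close> under dilation by \<open>sqrt 2\<close>.\<close>
  have "prob_space (gauss m (2 *\<^sub>R S))"
    using prob_space_gauss_dilate[OF prob_space_axioms pos_def, of "sqrt 2"] by simp
  then have "(\<integral>\<^sup>+x. ennreal (gauss_pdf m (2 *\<^sub>R S) x) \<partial>lborel) = 1"
    using prob_space.emeasure_space_1 unfolding gauss_def by (fastforce simp: emeasure_density)
  moreover have "ennreal (gauss_pdf m S x) * ennreal ((norm (x - m))\<^sup>2)
      \<le> ennreal K * ennreal (gauss_pdf m (2 *\<^sub>R S) x)" for x
    using ennreal_leI[OF K[of x]] \<open>K \<ge> 0\<close>
    by (metis ennreal_mult' ennreal_mult'' zero_le_power2)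
  then have "(\<integral>\<^sup>+x. ennreal ((norm (x - m))\<^sup>2) \<partial>gauss m S)
      \<le> (\<integral>\<^sup>+x. ennreal K * ennreal (gauss_pdf m (2 *\<^sub>R S) x) \<partial>lborel)"
    unfolding gauss_def by (subst nn_integral_density) (auto intro!: nn_integral_mono)
  ultimately show "(\<integral>\<^sup>+x. ennreal ((norm (x - m))\<^sup>2) \<partial>gauss m S) < \<infinity>"
    by (simp add: nn_integral_cmult le_less_trans)
qed auto

lemma integrable_quadratic_growth:
  fixes f :: "real^'n \<Rightarrow> 'b::{banach, second_countable_topology}"
  assumes [measurable]: "f \<in> borel_measurable borel"
    and growth: "\<And>x. norm (f x) \<le> a + b * norm (x - m) + c * (norm (x - m))\<^sup>2"
  shows "integrable (gauss m S) f"
proof -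
  have "integrable (gauss m S) (\<lambda>x. norm (x - m))"
    by (rule square_integrable_imp_integrable[OF _ integrable_norm_sq]) simp
  then have "integrable (gauss m S) (\<lambda>x. a + b * norm (x - m) + c * (norm (x - m))\<^sup>2)"
    using integrable_norm_sq by auto
  then show ?thesis
    by (rule Bochner_Integration.integrable_bound)
      (auto intro: order_trans[OF growth abs_ge_self])
qed

text \<open>\<open>Normal(m, S)\<close> is invariant under the reflection \<open>x \<mapsto> 2 m - x\<close>.\<close>
lemma integral_centered_eq_0: "(\<integral>x. x - m \<partial>gauss m S) = 0"
proof -
  have "(\<integral>x. x - m \<partial>gauss m S)
      = (\<integral>x. x - m \<partial>distr (gauss m S) lborel (\<lambda>x. m + (-1) *\<^sub>R (x - m)))"
    using distr_gauss_dilate[OF pos_def, of "-1" m] by simp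
  also have "\<dots> = - (\<integral>x. x - m \<partial>gauss m S)"
    by (subst integral_distr) (auto simp: integral_minus[symmetric])
  finally show ?thesis
    by (simp add: eq_neg_iff_add_eq_0 flip: scaleR_2)
qed

lemma integrable_ln_gauss_pdf: "integrable (gauss m S) (\<lambda>x. ln (gauss_pdf m S x))"
proof (rule integrable_quadratic_growth)
  fix x
  have "ln (gauss_pdf m S x) = ln (gauss_pdf m S m) - (x - m) \<bullet> (matrix_inv S *v (x - m)) / 2"
    using gauss_pdf_pos[OF pos_def, of m m] by (subst gauss_pdf_eq_at_mean) (simp add: ln_mult)
  then show "norm (ln (gauss_pdf m S x))
      \<le> \<bar>ln (gauss_pdf m S m)\<bar> + 0 * norm (x - m) + onorm ((*v) (matrix_inv S)) / 2 * (norm (x - m))\<^sup>2"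
    using abs_quadratic_form_le_onorm[of "x - m" "matrix_inv S"] by simp
qed simp

lemma free_energy_dilate:
  assumes [measurable]: "U \<in> borel_measurable borel" and t: "t > 0"
  shows "free_energy U m ((t^2) *\<^sub>R S)
    = (\<integral>x. U (m + t *\<^sub>R (x - m)) \<partial>gauss m S) + (\<integral>x. ln (gauss_pdf m S x) \<partial>gauss m S)
      - real CARD('n) * ln t"
proof -
  define T where "T = (\<lambda>x. m + t *\<^sub>R (x - m))"
  have [measurable]: "T \<in> borel_measurable borel"
    unfolding T_def by measurable
  have ln_pdf: "ln (gauss_pdf m ((t^2) *\<^sub>R S) (T x)) = ln (gauss_pdf m S x) - real CARD('n) * ln t"
    for x
  proof -
    have "gauss_pdf m S x = gauss_pdf m ((t^2) *\<^sub>R S) (T x) * t ^ CARD('n)"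
      using gauss_pdf_dilate[OF pos_def, of t m x] t unfolding T_def by simp
    then show ?thesis
      using gauss_pdf_pos[OF pos_def_mat_scaleR[OF pos_def], of "t^2" m "T x"] t
      by (simp add: ln_mult ln_realpow)
  qed
  have "free_energy U m ((t^2) *\<^sub>R S)
      = (\<integral>x. U (T x) \<partial>gauss m S) + (\<integral>x. ln (gauss_pdf m ((t^2) *\<^sub>R S) (T x)) \<partial>gauss m S)"
  proof -
    have "gauss m ((t^2) *\<^sub>R S) = distr (gauss m S) lborel T"
      using distr_gauss_dilate[OF pos_def, of t m] t unfolding T_def by simp
    then show ?thesis
      unfolding free_energy_def by (simp add: integral_distr)
  qed
  also have "(\<integral>x. ln (gauss_pdf m ((t^2) *\<^sub>R S) (T x)) \<partial>gauss m S)
      = (\<integral>x. ln (gauss_pdf m S x) \<partial>gauss m S) - real CARD('n) * ln t"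
    unfolding ln_pdf using integrable_ln_gauss_pdf prob_space by simp
  finally show ?thesis
    unfolding T_def by simp
qed

context
  fixes U :: "real^'n \<Rightarrow> real" and gradU :: "real^'n \<Rightarrow> real^'n" and L :: real
  assumes convex_smooth: "convex_smooth U gradU L"
begin

interpretation convex_smooth U gradU L
  by (fact convex_smooth)

lemma integrable_U_dilate: "integrable (gauss m S) (\<lambda>x. U (m + t *\<^sub>R (x - m)))"
proof (rule integrable_quadratic_growth)
  fix x
  show "norm (U (m + t *\<^sub>R (x - m)))
      \<le> \<bar>U m\<bar> + norm (gradU m) * \<bar>t\<bar> * norm (x - m) + L / 2 * t\<^sup>2 * (norm (x - m))\<^sup>2"
    using abs_U_le_quadratic[of "m + t *\<^sub>R (x - m)" m] by (simp add: power_mult_distrib)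
qed simp

lemma integrable_gradU: "integrable (gauss m S) gradU"
  using norm_gradU_le_affine by (intro integrable_quadratic_growth[where c = 0]) auto

lemma integrable_gradU_inner: "integrable (gauss m S) (\<lambda>x. gradU x \<bullet> (x - m))"
proof (rule integrable_quadratic_growth)
  fix x
  have "\<bar>gradU x \<bullet> (x - m)\<bar> \<le> norm (gradU x) * norm (x - m)"
    by (rule Cauchy_Schwarz_ineq2)
  also have "\<dots> \<le> (norm (gradU m) + L * norm (x - m)) * norm (x - m)"
    by (intro mult_right_mono norm_gradU_le_affine) simp
  finally show "norm (gradU x \<bullet> (x - m)) \<le> 0 + norm (gradU m) * norm (x - m) + L * (norm (x - m))\<^sup>2"
    by (simp add: algebra_simps power2_eq_square)
qed simp

lemma integrable_norm_gradU_diff_sq: "integrable (gauss m S) (\<lambda>x. (norm (gradU x - gradU m))\<^sup>2)"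
proof (rule integrable_quadratic_growth)
  fix x
  show "norm ((norm (gradU x - gradU m))\<^sup>2) \<le> 0 + 0 * norm (x - m) + L\<^sup>2 * (norm (x - m))\<^sup>2"
    using power_mono[OF gradU_lipschitz[of x m], of 2] by (simp add: power_mult_distrib)
qed simp

lemma ln_le_of_free_energy_le_dilate:
  assumes minimal: "free_energy U m S \<le> free_energy U m ((t^2) *\<^sub>R S)" and t: "t > 0"
  shows "real CARD('n) * ln t
    \<le> (t - 1) * (\<integral>x. gradU x \<bullet> (x - m) \<partial>gauss m S)
      + L / 2 * (t - 1)\<^sup>2 * (\<integral>x. (norm (x - m))\<^sup>2 \<partial>gauss m S)"
proof -
  have "real CARD('n) * ln t
      \<le> (\<integral>x. U (m + t *\<^sub>R (x - m)) \<partial>gauss m S) - (\<integral>x. U x \<partial>gauss m S)"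
    using minimal free_energy_dilate[OF borel_measurable_U t]
    unfolding free_energy_def by simp
  also have "(\<integral>x. U (m + t *\<^sub>R (x - m)) \<partial>gauss m S)
      \<le> (\<integral>x. U x + (t - 1) * (gradU x \<bullet> (x - m)) + L / 2 * (t - 1)\<^sup>2 * (norm (x - m))\<^sup>2 \<partial>gauss m S)"
  proof (rule integral_mono)
    fix x
    show "U (m + t *\<^sub>R (x - m))
        \<le> U x + (t - 1) * (gradU x \<bullet> (x - m)) + L / 2 * (t - 1)\<^sup>2 * (norm (x - m))\<^sup>2"
    proof -
      have "x + (t - 1) *\<^sub>R (x - m) = m + t *\<^sub>R (x - m)"
        by (simp add: algebra_simps)
      moreover have "(norm ((t - 1) *\<^sub>R (x - m)))\<^sup>2 = (t - 1)\<^sup>2 * (norm (x - m))\<^sup>2"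
        by (simp add: power_mult_distrib)
      ultimately show ?thesis
        using le_tangent_plus_sq[of x "(t - 1) *\<^sub>R (x - m)"] by (simp add: mult.assoc)
    qed
  qed (use integrable_U_dilate[of 1] integrable_U_dilate integrable_gradU_inner integrable_norm_sq
      in auto)
  finally show ?thesis
    using integrable_U_dilate[of 1] integrable_gradU_inner integrable_norm_sq by simp
qed

text \<open>Letting \<open>t \<rightarrow> 1\<^sup>-\<close> in \<open>ln_le_of_free_energy_le_dilate\<close> compares the left derivatives
  of both sides at \<open>t = 1\<close>.\<close>
lemma integral_gradU_inner_le_dim:
  assumes minimal: "\<And>t. 0 < t \<Longrightarrow> t < 1 \<Longrightarrow> free_energy U m S \<le> free_energy U m ((t^2) *\<^sub>R S)"
  shows "(\<integral>x. gradU x \<bullet> (x - m) \<partial>gauss m S) \<le> real CARD('n)"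
proof -
  define G where "G = (\<integral>x. gradU x \<bullet> (x - m) \<partial>gauss m S)"
  define M where "M = (\<integral>x. (norm (x - m))\<^sup>2 \<partial>gauss m S)"
  have bound: "G \<le> real CARD('n) / (1 - s) + L * M / 2 * s" if s: "0 < s" "s < 1" for s
  proof -
    have "- (real CARD('n) * ln (1 - s)) \<le> real CARD('n) * (s / (1 - s))"
      using mult_left_mono[OF minus_ln_one_minus_le[OF s], of "real CARD('n)"] by simp
    moreover have "real CARD('n) * ln (1 - s) \<le> - s * G + L / 2 * s\<^sup>2 * M"
      using ln_le_of_free_energy_le_dilate[OF minimal, of "1 - s"] s unfolding G_def M_def by simp
    ultimately have "s * G \<le> s * (real CARD('n) / (1 - s) + L * M / 2 * s)"
      by (simp add: algebra_simps power2_eq_square)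
    then show ?thesis
      using s by simp
  qed
  have "((\<lambda>s. real CARD('n) / (1 - s) + L * M / 2 * s) \<longlongrightarrow> real CARD('n)) (at_right 0)"
    by (auto intro!: tendsto_eq_intros)
  moreover have "\<forall>\<^sub>F s in at_right 0. G \<le> real CARD('n) / (1 - s) + L * M / 2 * s"
    unfolding eventually_at_right_field using bound by (intro exI[of _ 1]) auto
  ultimately show ?thesis
    unfolding G_def[symmetric] by (intro tendsto_lowerbound) auto
qed

lemma integral_norm_gradU_diff_sq_le:
  "(\<integral>x. (norm (gradU x - gradU m))\<^sup>2 \<partial>gauss m S) \<le> L * (\<integral>x. gradU x \<bullet> (x - m) \<partial>gauss m S)"
proof -
  have centered: "integrable (gauss m S) (\<lambda>x. x - m)"
    using integrable_quadratic_growth[of "\<lambda>x. x - m" 0 1 0] by simp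
  have "(\<integral>x. (norm (gradU x - gradU m))\<^sup>2 \<partial>gauss m S)
      \<le> (\<integral>x. L * (gradU x \<bullet> (x - m)) - L * (gradU m \<bullet> (x - m)) \<partial>gauss m S)"
  proof (rule integral_mono[OF integrable_norm_gradU_diff_sq])
    show "integrable (gauss m S) (\<lambda>x. L * (gradU x \<bullet> (x - m)) - L * (gradU m \<bullet> (x - m)))"
      using centered integrable_gradU_inner by auto
    show "(norm (gradU x - gradU m))\<^sup>2 \<le> L * (gradU x \<bullet> (x - m)) - L * (gradU m \<bullet> (x - m))" for x
      using gradU_cocoercive[of x m] by (simp add: inner_diff_left algebra_simps)
  qed
  also have "\<dots> = L * (\<integral>x. gradU x \<bullet> (x - m) \<partial>gauss m S)"
    using centered integrable_gradU_inner integral_centered_eq_0 by simp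
  finally show ?thesis .
qed

lemma variance_gradU_le_dim:
  assumes minimal: "\<And>t. 0 < t \<Longrightarrow> t < 1 \<Longrightarrow> free_energy U m S \<le> free_energy U m ((t^2) *\<^sub>R S)"
  shows "integrable (gauss m S) (\<lambda>x. (norm (gradU x - expectation gradU))\<^sup>2)"
    and "(\<integral>x. (norm (gradU x - expectation gradU))\<^sup>2 \<partial>gauss m S) \<le> L * real CARD('n)"
proof -
  note variance = integral_norm_sq_diff_expectation_le[OF integrable_gradU integrable_norm_gradU_diff_sq]
  show "integrable (gauss m S) (\<lambda>x. (norm (gradU x - expectation gradU))\<^sup>2)"
    by (fact variance(1))
  have "(\<integral>x. (norm (gradU x - expectation gradU))\<^sup>2 \<partial>gauss m S)
      \<le> (\<integral>x. (norm (gradU x - gradU m))\<^sup>2 \<partial>gauss m S)"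
    by (fact variance(2))
  also have "\<dots> \<le> L * (\<integral>x. gradU x \<bullet> (x - m) \<partial>gauss m S)"
    by (rule integral_norm_gradU_diff_sq_le)
  also have "\<dots> \<le> L * real CARD('n)"
    using L_pos integral_gradU_inner_le_dim[OF minimal] by (intro mult_left_mono) auto
  finally show "(\<integral>x. (norm (gradU x - expectation gradU))\<^sup>2 \<partial>gauss m S) \<le> L * real CARD('n)" .
qed

end

end

lemma nn_integral_le_coupling:
  fixes \<psi> :: "('a::euclidean_space \<times> 'b::euclidean_space) measure"
    and f :: "'a \<Rightarrow> real" and g :: "'a \<Rightarrow> 'b \<Rightarrow> real" and h :: "'b \<Rightarrow> real"
  assumes sets: "sets \<psi> = sets borel"
    and fst: "distr \<psi> lborel fst = P" and snd: "distr \<psi> lborel snd = Q"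
    and [measurable]: "f \<in> borel_measurable borel" "h \<in> borel_measurable borel"
      "(\<lambda>p. g (fst p) (snd p)) \<in> borel_measurable (borel \<Otimes>\<^sub>M borel)"
    and le: "\<And>x y. f x \<le> a * g x y + h y"
    and nonneg: "0 \<le> a" "\<And>x y. 0 \<le> g x y" "\<And>y. 0 \<le> h y"
  shows "(\<integral>\<^sup>+x. f x \<partial>P) \<le> ennreal a * (\<integral>\<^sup>+p. g (fst p) (snd p) \<partial>\<psi>) + (\<integral>\<^sup>+y. h y \<partial>Q)"
proof -
  have sets_prod[measurable_cong]: "sets \<psi> = sets (borel \<Otimes>\<^sub>M borel)"
    unfolding sets borel_prod ..
  have [measurable]: "fst \<in> measurable \<psi> lborel" "snd \<in> measurable \<psi> lborel"
    unfolding measurable_lborel1 by measurable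
  have "(\<integral>\<^sup>+x. f x \<partial>P) = (\<integral>\<^sup>+p. f (fst p) \<partial>\<psi>)"
    unfolding fst[symmetric] by (simp add: nn_integral_distr)
  also have "\<dots> \<le> (\<integral>\<^sup>+p. ennreal a * g (fst p) (snd p) + h (snd p) \<partial>\<psi>)"
  proof (rule nn_integral_mono)
    fix p
    have "ennreal (f (fst p)) \<le> ennreal (a * g (fst p) (snd p) + h (snd p))"
      using le by (rule ennreal_leI)
    also have "\<dots> = ennreal a * g (fst p) (snd p) + h (snd p)"
      using nonneg by (simp add: ennreal_mult'' ennreal_plus)
    finally show "ennreal (f (fst p)) \<le> ennreal a * g (fst p) (snd p) + h (snd p)" .
  qed
  also have "\<dots> = ennreal a * (\<integral>\<^sup>+p. g (fst p) (snd p) \<partial>\<psi>) + (\<integral>\<^sup>+p. h (snd p) \<partial>\<psi>)"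
    by (simp add: nn_integral_add nn_integral_cmult)
  also have "(\<integral>\<^sup>+p. h (snd p) \<partial>\<psi>) = (\<integral>\<^sup>+y. h y \<partial>Q)"
    unfolding snd[symmetric] by (simp add: nn_integral_distr)
  finally show ?thesis .
qed

lemma nn_integral_norm_gradU_sub_sq_le_coupling:
  fixes U :: "real^'n \<Rightarrow> real" and \<psi> :: "((real^'n) \<times> (real^'n)) measure"
  assumes "convex_smooth U gradU L" and "sets \<psi> = sets borel"
    and "distr \<psi> lborel fst = P" and "distr \<psi> lborel snd = Q"
  shows "(\<integral>\<^sup>+x. ennreal ((norm (gradU x - c))\<^sup>2) \<partial>P)
    \<le> ennreal (4 * L) * (\<integral>\<^sup>+p. ennreal (bregman U gradU (fst p) (snd p)) \<partial>\<psi>)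
      + (\<integral>\<^sup>+y. ennreal (2 * (norm (gradU y - c))\<^sup>2) \<partial>Q)"
proof -
  interpret convex_smooth U gradU L
    by fact
  show ?thesis
  proof (rule nn_integral_le_coupling[OF assms(2-4)])
    show "(\<lambda>p. bregman U gradU (fst p) (snd p)) \<in> borel_measurable (borel \<Otimes>\<^sub>M borel)"
      unfolding bregman_def by measurable
    show "(\<lambda>x. (norm (gradU x - c))\<^sup>2) \<in> borel_measurable borel"
      by measurable
    show "(\<lambda>y. 2 * (norm (gradU y - c))\<^sup>2) \<in> borel_measurable borel"
      by measurable
    show "(norm (gradU x - c))\<^sup>2 \<le> 4 * L * bregman U gradU x y + 2 * (norm (gradU y - c))\<^sup>2"
      for x y
      using norm_gradU_sub_sq_le[of x c y] by (simp add: bregman_def)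
    show "0 \<le> bregman U gradU x y" for x y
      using tangent_le[of y "x - y"] by (simp add: bregman_def)
  qed (use L_pos in auto)
qed

theorem lemmaC7:
  fixes U :: "real^'n \<Rightarrow> real"
    and gradU :: "real^'n \<Rightarrow> real^'n"
    and H :: "real^'n \<Rightarrow> real^'n \<Rightarrow> real^'n"
    and \<mu> L :: real
    and ms m :: "real^'n"
    and Ss S :: "real^'n^'n"
    and \<psi> :: "((real^'n) \<times> (real^'n)) measure"
  assumes mu_pos: "\<mu> > 0" and L_nonneg: "L \<ge> 0"
    and grad: "\<And>z. (U has_derivative (\<lambda>h. gradU z \<bullet> h)) (at z)"
    and hess: "\<And>z. (gradU has_derivative H z) (at z)"
    and hess_lower: "\<And>z h. \<mu> * (norm h)\<^sup>2 \<le> h \<bullet> H z h"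
    and hess_upper: "\<And>z h. h \<bullet> H z h \<le> L * (norm h)\<^sup>2"
    and qs_BW: "pos_def_mat Ss"
    and qs_min: "\<And>m' S'. pos_def_mat S' \<Longrightarrow> free_energy U ms Ss \<le> free_energy U m' S'"
    and q_BW: "pos_def_mat S"
    and psi_prob: "prob_space \<psi>"
    and psi_sets: "sets \<psi> = sets borel"
    and psi_fst: "distr \<psi> lborel fst = gauss m S"
    and psi_snd: "distr \<psi> lborel snd = gauss ms Ss"
  shows "(\<integral>\<^sup>+ z. ennreal ((norm (gradU z - (\<integral>x. gradU x \<partial>gauss ms Ss)))\<^sup>2) \<partial>gauss m S)
         \<le> ennreal (4 * L) * (\<integral>\<^sup>+ p. ennreal (bregman U gradU (fst p) (snd p)) \<partial>\<psi>)
           + ennreal (2 * real CARD('n) * L)"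
proof -
  interpret convex_smooth U gradU L
    by (rule convex_smoothI_hessian[OF grad hess hess_lower hess_upper mu_pos])
  have "prob_space (gauss ms Ss)"
    using prob_space.prob_space_distr[OF psi_prob, of snd lborel] psi_snd
    unfolding measurable_lborel1 by (simp add: measurable_cong_sets[OF psi_sets refl] borel_prod[symmetric])
  then interpret q: nondegenerate_gaussian ms Ss
    using qs_BW by (simp add: nondegenerate_gaussian_def nondegenerate_gaussian_axioms_def)
  note variance = q.variance_gradU_le_dim[OF convex_smooth_axioms qs_min[OF pos_def_mat_scaleR[OF qs_BW]]]
  define c where "c = (\<integral>x. gradU x \<partial>gauss ms Ss)"
  have "(\<integral>\<^sup>+z. ennreal ((norm (gradU z - c))\<^sup>2) \<partial>gauss m S)
      \<le> ennreal (4 * L) * (\<integral>\<^sup>+p. ennreal (bregman U gradU (fst p) (snd p)) \<partial>\<psi>)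
        + (\<integral>\<^sup>+y. ennreal (2 * (norm (gradU y - c))\<^sup>2) \<partial>gauss ms Ss)"
    by (rule nn_integral_norm_gradU_sub_sq_le_coupling[OF convex_smooth_axioms psi_sets psi_fst psi_snd])
  also have "(\<integral>\<^sup>+y. ennreal (2 * (norm (gradU y - c))\<^sup>2) \<partial>gauss ms Ss)
      = ennreal (\<integral>y. 2 * (norm (gradU y - c))\<^sup>2 \<partial>gauss ms Ss)"
    using variance(1) unfolding c_def by (intro nn_integral_eq_integral) simp_all
  also have "\<dots> \<le> ennreal (2 * real CARD('n) * L)"
    using variance(2) unfolding c_def by (intro ennreal_leI) (simp add: mult.commute)
  finally show ?thesis
    unfolding c_def by (simp add: add_left_mono)
qed

end
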